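(* Let $T\ge1$, $K\in\{0,1,\dots,T-1\}$, $c(t)\ge0$ for $t=1,\dots,T$, $\eta>0$ and $\alpha\in[0,1)$. Suppose the aggregation weights $\mathbf q(t)$ are generated by the Fixed Share algorithm with learning rate $\eta$ and mixing parameter $\alpha$ run on the cost-sensitive expert losses $\tilde\ell_j(t)$. Then $$R^c_{\rm track}(T,K)\le\frac{\mathcal C(K,\alpha,n,T)}{\eta}+\frac{\eta}{8}\sum_{t=1}^T(b-a+2c(t))^2+\eta\sum_{t=2}^Tc(t)\,(b-a+2c(t-1))+2\alpha\left(1-\frac1n\right)\sum_{t=1}^Tc(t),$$ where $$\mathcal C(K,\alpha,n,T):=\begin{cases}\log n&\text{if }\alpha=0\text{ and }K=0,\\ \infty&\text{if }\alpha=0\text{ and }K>0,\\ (K+1)\log n+K\log\frac1\alpha+(T-K-1)\log\frac1{1-\alpha}&\text{otherwise.}\end{cases}$$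
   Context: Let $m\ge2$ (number of assets), $\mathcal W:=\{\mathbf w\in\mathbb R_+^m:\mathbf w^\top\mathbf 1=1\}$, and $\mathcal Y\subseteq\mathbb R^m$. Let $\mathcal N$ be a finite set of $n\ge2$ experts. The loss $\ell:\mathcal W\times\mathcal Y\to\mathbb R$ is convex in its first argument and satisfies $a\le\ell(\mathbf w,\mathbf y)\le b$ for all $(\mathbf w,\mathbf y)$, where $a<b$ are fixed real constants. A prescribed initial portfolio $\mathbf w_0\in\mathcal W$ is given. Each expert $j\in\mathcal N$ provides portfolios $\mathbf w_j(t)\in\mathcal W$ for $t\ge1$, with $\mathbf w_j(0):=\mathbf w_0$; the outcomes are $\mathbf y(t)\in\mathcal Y$. The cost-sensitive loss of expert $j$ at time $t\ge1$ is $\tilde\ell_j(t):=\ell(\mathbf w_j(t),\mathbf y(t))+c(t)\|\mathbf w_j(t)-\mathbf w_j(t-1)\|_1$. Fixed Share with learning rate $\eta>0$ and mixing parameter $\alpha$: $q_j(1)=1/n$ for all $j\in\mathcal N$, and for $t\ge1$, $$q_j^{\mathrm{exp}}(t)=\frac{q_j(t)e^{-\eta\tilde\ell_j(t)}}{\sum_{k\in\mathcal N}q_k(t)e^{-\eta\tilde\ell_k(t)}},\qquad q_j(t+1)=(1-\alpha)q_j^{\mathrm{exp}}(t)+\frac{\alpha}{n}.$$ The aggregate portfolio is $\widehat{\mathbf w}(t):=\sum_{j\in\mathcal N}q_j(t)\mathbf w_j(t)$ for $t\ge1$, with $\widehat{\mathbf w}(0):=\mathbf w_0$. For $\mathbf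 j=(j_1,\dots,j_T)\in\mathcal N^T$, let $S_T(\mathbf j):=\#\{t\in\{1,\dots,T-1\}:j_t\ne j_{t+1}\}$ and $\mathcal J_{T,K}:=\{\mathbf j\in\mathcal N^T:S_T(\mathbf j)\le K\}$. The cost-sensitive tracking regret is $$R^c_{\rm track}(T,K):=\sum_{t=1}^T\left[\ell(\widehat{\mathbf w}(t),\mathbf y(t))+c(t)\|\widehat{\mathbf w}(t)-\widehat{\mathbf w}(t-1)\|_1\right]-\min_{\mathbf j\in\mathcal J_{T,K}}\sum_{t=1}^T\tilde\ell_{j_t}(t).$$ *)

theory Defs
  imports "HOL-Analysis.Analysis"
begin

definition portfolios :: "(real ^ 'm) set" where
  "portfolios = {w. (\<forall>i. 0 \<le> w $ i) \<and> (\<Sum>i\<in>UNIV. w $ i) = 1}"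

definition l1_norm :: "real ^ 'm \<Rightarrow> real" where
  "l1_norm x = (\<Sum>i\<in>UNIV. \<bar>x $ i\<bar>)"

text \<open>Rounds are numbered from 1; index 0 carries only the initial portfolio.\<close>

definition cs_loss ::
  "(real ^ 'm \<Rightarrow> 'y \<Rightarrow> real) \<Rightarrow> (nat \<Rightarrow> 'y) \<Rightarrow> (nat \<Rightarrow> real) \<Rightarrow>
    (nat \<Rightarrow> real ^ 'm) \<Rightarrow> nat \<Rightarrow> real" where
  "cs_loss l y c v t = l (v t) (y t) + c t * l1_norm (v t - v (t - 1))"

text \<open>
  Only the values of \<open>q t j\<close> and \<open>L j t\<close> with \<open>t \<ge> 1\<close> and \<open>j \<in> N\<close> matter here,
  where \<open>L j t\<close> is the loss of expert \<open>j\<close> in round \<open>t\<close>.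
\<close>

definition exp_update ::
  "'e set \<Rightarrow> real \<Rightarrow> ('e \<Rightarrow> nat \<Rightarrow> real) \<Rightarrow> (nat \<Rightarrow> 'e \<Rightarrow> real) \<Rightarrow> nat \<Rightarrow> 'e \<Rightarrow> real" where
  "exp_update N \<eta> L q t j =
     q t j * exp (- \<eta> * L j t) / (\<Sum>k\<in>N. q t k * exp (- \<eta> * L k t))"

definition fixed_share ::
  "'e set \<Rightarrow> real \<Rightarrow> real \<Rightarrow> ('e \<Rightarrow> nat \<Rightarrow> real) \<Rightarrow> (nat \<Rightarrow> 'e \<Rightarrow> real) \<Rightarrow> bool" where
  "fixed_share N \<eta> \<alpha> L q \<longleftrightarrow>
     (\<forall>j\<in>N. q 1 j = 1 / real (card N)) \<and>
     (\<forall>t\<ge>1. \<forall>j\<in>N. q (t + 1) j =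
        (1 - \<alpha>) * exp_update N \<eta> L q t j + \<alpha> / real (card N))"

definition aggregate ::
  "'e set \<Rightarrow> real ^ 'm \<Rightarrow> ('e \<Rightarrow> nat \<Rightarrow> real ^ 'm) \<Rightarrow> (nat \<Rightarrow> 'e \<Rightarrow> real) \<Rightarrow>
    nat \<Rightarrow> real ^ 'm" where
  "aggregate N w0 w q t = (if t = 0 then w0 else (\<Sum>j\<in>N. q t j *\<^sub>R w j t))"

definition switches :: "nat \<Rightarrow> (nat \<Rightarrow> 'e) \<Rightarrow> nat" where
  "switches T p = card {t \<in> {1..T - 1}. p t \<noteq> p (t + 1)}"

definition expert_paths :: "'e set \<Rightarrow> nat \<Rightarrow> nat \<Rightarrow> (nat \<Rightarrow> 'e) set" where
  "expert_paths N T K = {p \<in> {1..T} \<rightarrow>\<^sub>E N. switches T p \<le> K}"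

definition tracking_regret ::
  "'e set \<Rightarrow> (real ^ 'm \<Rightarrow> 'y \<Rightarrow> real) \<Rightarrow> (nat \<Rightarrow> 'y) \<Rightarrow> (nat \<Rightarrow> real) \<Rightarrow>
    real ^ 'm \<Rightarrow> ('e \<Rightarrow> nat \<Rightarrow> real ^ 'm) \<Rightarrow> (nat \<Rightarrow> 'e \<Rightarrow> real) \<Rightarrow> nat \<Rightarrow> nat \<Rightarrow> real" where
  "tracking_regret N l y c w0 w q T K =
     (\<Sum>t = 1..T. cs_loss l y c (aggregate N w0 w q) t)
     - (MIN p \<in> expert_paths N T K. \<Sum>t = 1..T. cs_loss l y c (w (p t)) t)"

definition complexity :: "nat \<Rightarrow> real \<Rightarrow> nat \<Rightarrow> nat \<Rightarrow> ereal" where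
  "complexity K \<alpha> n T =
     (if \<alpha> = 0 \<and> K = 0 then ereal (ln (real n))
      else if \<alpha> = 0 \<and> K > 0 then \<infinity>
      else ereal ((real K + 1) * ln (real n) + real K * ln (1 / \<alpha>)
                  + (real T - real K - 1) * ln (1 / (1 - \<alpha>))))"

end

theory Submission
  imports Defs "HOL-Probability.Hoeffding"
begin

text \<open>
  The cost of the aggregate portfolio in one round splits into two parts. Writing
  the move of the aggregate as
  \<open>(\<Sum>j. q t j (w j t - w j (t - 1))) + (\<Sum>j. (q t j - q (t - 1) j) w j (t - 1))\<close>,
  the first sum, together with convexity of the loss, is paid for by the \<open>q\<close>-average of the
  cost-sensitive expert losses, while the second is at most the l1 distance between consecutive
  weight vectors, because portfolios have l1 norm 1 (\<open>aggregate_loss_le\<close>). So the aggregate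
  loses at most the average expert loss plus \<open>c t\<close> times the variation of the weights.

  The variation is small for two reasons: exponential tilting by losses of range \<open>R\<close> moves a
  probability vector by at most \<open>\<eta> R\<close> in l1 norm, and mixing with the uniform distribution moves it
  by at most \<open>2 \<alpha> (1 - 1 / n)\<close> (\<open>fixed_share_variation\<close>).
  In round 1 all experts start from the same portfolio, so any reference weights describe round 0
  and there is no variation term at all.

  The average loss is treated as in the usual analysis of Fixed Share. Hoeffding's lemma replaces it
  by the mix loss \<open>- ln (normalizer t) / \<eta>\<close> at the price \<open>\<eta> R\<^sup>2 / 8\<close>. The product of the
  normalizers is the total weight of a Bayesian mixture over expert paths, whose prior is a Markov
  chain that starts uniformly, stays with probability \<open>1 - \<alpha> + \<alpha> / n\<close> and makes each possible
  switch with probability \<open>\<alpha> / n\<close>. Hence it dominates the contribution of any single path, and a path with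
  at most \<open>K\<close> switches has prior at least \<open>(1 / n) (\<alpha> / n)^K (1 - \<alpha>)^(T - 1 - K)\<close>; its
  negative logarithm is the complexity term (\<open>fixed_share_mix_loss_le\<close>).
\<close>

section \<open>The l1 norm on portfolios\<close>

lemma l1_norm_nonneg: "0 \<le> l1_norm x"
  by (simp add: l1_norm_def sum_nonneg)

lemma l1_norm_add_le: "l1_norm (x + y) \<le> l1_norm x + l1_norm y"
  unfolding l1_norm_def by (simp flip: sum.distrib add: sum_mono abs_triangle_ineq)

lemma l1_norm_scaleR: "l1_norm (r *\<^sub>R x) = \<bar>r\<bar> * l1_norm x"
  by (simp add: l1_norm_def abs_mult sum_distrib_left)

lemma l1_norm_sum_le: "l1_norm (\<Sum>j\<in>A. f j) \<le> (\<Sum>j\<in>A. l1_norm (f j))"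
proof (induction A rule: infinite_finite_induct)
  case (insert j A)
  then show ?case
    using l1_norm_add_le[of "f j" "\<Sum>j\<in>A. f j"] by simp
qed (simp_all add: l1_norm_def)

lemma l1_norm_portfolio: "u \<in> portfolios \<Longrightarrow> l1_norm u = 1"
  by (simp add: portfolios_def l1_norm_def)

lemma l1_norm_portfolio_diff_le:
  assumes "u \<in> portfolios" "v \<in> portfolios"
  shows "l1_norm (u - v) \<le> 2"
  using l1_norm_add_le[of u "- 1 *\<^sub>R v"] l1_norm_scaleR[of "-1" v]
  by (simp add: l1_norm_portfolio assms)

text \<open>
  A mixture moves because its components move and because its weights do; the \<open>p\<close> and \<open>v\<close> in the
  two error terms come from adding and subtracting the mixture of the old components \<open>v\<close> under the
  new weights \<open>p\<close>.
\<close>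
lemma l1_norm_mixture_diff_le:
  fixes u v :: "'e \<Rightarrow> real ^ 'm" and p p' :: "'e \<Rightarrow> real"
  assumes "\<And>j. j \<in> N \<Longrightarrow> 0 \<le> p j"
    and v: "\<And>j. j \<in> N \<Longrightarrow> v j \<in> portfolios"
  shows "l1_norm ((\<Sum>j\<in>N. p j *\<^sub>R u j) - (\<Sum>j\<in>N. p' j *\<^sub>R v j))
    \<le> (\<Sum>j\<in>N. p j * l1_norm (u j - v j)) + (\<Sum>j\<in>N. \<bar>p j - p' j\<bar>)"
proof -
  have "(\<Sum>j\<in>N. p j *\<^sub>R u j) - (\<Sum>j\<in>N. p' j *\<^sub>R v j)
      = (\<Sum>j\<in>N. p j *\<^sub>R (u j - v j)) + (\<Sum>j\<in>N. (p j - p' j) *\<^sub>R v j)"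
    by (simp flip: sum.distrib sum_subtractf add: algebra_simps)
  also have "l1_norm \<dots> \<le> l1_norm (\<Sum>j\<in>N. p j *\<^sub>R (u j - v j)) + l1_norm (\<Sum>j\<in>N. (p j - p' j) *\<^sub>R v j)"
    by (rule l1_norm_add_le)
  also have "\<dots> \<le> (\<Sum>j\<in>N. l1_norm (p j *\<^sub>R (u j - v j))) + (\<Sum>j\<in>N. l1_norm ((p j - p' j) *\<^sub>R v j))"
    by (intro add_mono l1_norm_sum_le)
  also have "\<dots> = (\<Sum>j\<in>N. p j * l1_norm (u j - v j)) + (\<Sum>j\<in>N. \<bar>p j - p' j\<bar>)"
    using assms by (simp add: l1_norm_scaleR l1_norm_portfolio)
  finally show ?thesis .
qed

section \<open>The weights of Fixed Share\<close>

text \<open>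
  The negative logarithm of this quantity, divided by \<open>\<eta>\<close>, is the mix loss of the round.
\<close>
definition normalizer ::
  "'e set \<Rightarrow> real \<Rightarrow> ('e \<Rightarrow> nat \<Rightarrow> real) \<Rightarrow> (nat \<Rightarrow> 'e \<Rightarrow> real) \<Rightarrow> nat \<Rightarrow> real" where
  "normalizer N \<eta> L q t = (\<Sum>k\<in>N. q t k * exp (- \<eta> * L k t))"

lemma exp_update_normalizer:
  "exp_update N \<eta> L q t j = q t j * exp (- \<eta> * L j t) / normalizer N \<eta> L q t"
  by (simp add: exp_update_def normalizer_def)

lemma normalizer_pos:
  assumes "finite N" "N \<noteq> {}" "\<And>j. j \<in> N \<Longrightarrow> 0 < q t j"
  shows "0 < normalizer N \<eta> L q t"
  unfolding normalizer_def using assms by (intro sum_pos) auto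

lemma sum_exp_update:
  assumes "finite N" "N \<noteq> {}" "\<And>j. j \<in> N \<Longrightarrow> 0 < q t j"
  shows "(\<Sum>j\<in>N. exp_update N \<eta> L q t j) = 1"
  using normalizer_pos[of N q t \<eta> L] assms
  by (simp add: exp_update_normalizer flip: sum_divide_distrib) (simp add: normalizer_def)

lemma exp_update_pos:
  assumes "finite N" "N \<noteq> {}" "\<And>j. j \<in> N \<Longrightarrow> 0 < q t j" "j \<in> N"
  shows "0 < exp_update N \<eta> L q t j"
  using normalizer_pos[of N q t \<eta> L] assms by (simp add: exp_update_normalizer)

lemma exp_update_le_1:
  assumes "finite N" "N \<noteq> {}" "\<And>j. j \<in> N \<Longrightarrow> 0 < q t j" "j \<in> N"
  shows "exp_update N \<eta> L q t j \<le> 1"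
  using member_le_sum[of j N "exp_update N \<eta> L q t"] sum_exp_update[of N q t \<eta> L]
    exp_update_pos[of N q t _ \<eta> L] assms by (simp add: less_imp_le)

text \<open>
  Strict positivity is carried along because it makes every normalizer positive; it survives
  \<open>\<alpha> = 0\<close> since exponential factors never vanish and \<open>\<alpha> < 1\<close>.
\<close>
lemma fixed_share_weights:
  assumes N: "finite N" "N \<noteq> {}" and "0 \<le> \<alpha>" "\<alpha> < 1"
    and fs: "fixed_share N \<eta> \<alpha> L q" and "1 \<le> t"
  shows "(\<forall>j\<in>N. 0 < q t j) \<and> (\<Sum>j\<in>N. q t j) = 1"
  using \<open>1 \<le> t\<close>
proof (induction t rule: dec_induct)
  case base
  then show ?case using fs N by (simp add: fixed_share_def card_gt_0_iff)
next
  case (step t)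
  have q: "q (Suc t) j = (1 - \<alpha>) * exp_update N \<eta> L q t j + \<alpha> / real (card N)" if "j \<in> N" for j
    using fs step.hyps that by (auto simp: fixed_share_def)
  have "0 < q (Suc t) j" if "j \<in> N" for j
    using exp_update_pos[of N q t j \<eta> L] N step.IH that q[OF that] \<open>0 \<le> \<alpha>\<close> \<open>\<alpha> < 1\<close>
    by (simp add: add_pos_nonneg)
  moreover have "(\<Sum>j\<in>N. q (Suc t) j) = 1"
    using sum_exp_update[of N q t \<eta> L] N step.IH
    by (simp add: q sum.distrib flip: sum_distrib_left)
  ultimately show ?case by blast
qed

section \<open>One-step variation of the weights\<close>

lemma one_minus_exp_le_half:
  fixes d :: real
  assumes "0 \<le> d"
  shows "1 - exp (- d) \<le> d * ((1 + exp (- d)) / 2)"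
proof -
  define f where "f x = x * ((1 + exp (- x)) / 2) - (1 - exp (- x))" for x :: real
  have "f 0 \<le> f d"
  proof (rule DERIV_nonneg_imp_nondecreasing[OF assms])
    fix x :: real
    have "(f has_real_derivative ((1 - exp (- x) - x * exp (- x)) / 2)) (at x)"
      unfolding f_def by (auto intro!: derivative_eq_intros simp: field_simps)
    moreover have "(1 + x) * exp (- x) \<le> 1"
      using exp_ge_add_one_self[of x] by (simp add: exp_minus field_simps)
    ultimately show "\<exists>y. (f has_real_derivative y) (at x) \<and> 0 \<le> y"
      by (intro exI[of _ "(1 - exp (- x) - x * exp (- x)) / 2"]) (simp add: algebra_simps)
  qed
  then show ?thesis by (simp add: f_def)
qed

text \<open>
  The logarithmic mean of \<open>exp x\<close> and \<open>exp y\<close> is at most their arithmetic mean. Bounding by the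
  larger of the two exponentials instead would cost a factor of 2 in the weight variation.
\<close>
lemma abs_exp_diff_le_mean:
  fixes x y :: real
  shows "\<bar>exp x - exp y\<bar> \<le> \<bar>x - y\<bar> * ((exp x + exp y) / 2)"
proof (induction x y rule: linorder_wlog)
  case (le x y)
  have "exp y * (1 - exp (- (y - x))) \<le> exp y * ((y - x) * ((1 + exp (- (y - x))) / 2))"
    using le by (intro mult_left_mono one_minus_exp_le_half) auto
  moreover have "exp y * exp (- (y - x)) = exp x" by (simp flip: exp_add)
  ultimately show ?case using le by (simp add: algebra_simps)
qed (simp add: algebra_simps abs_minus_commute)

text \<open>
  The change of the weight of \<open>j\<close> is \<open>q t j (e j - Z) / Z\<close>, where \<open>e j\<close> is the exponential factor of
  \<open>j\<close> and \<open>Z\<close> is the \<open>q\<close>-average of these factors. Thus the total change is at most the average of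
  \<open>\<bar>e j - e k\<bar> / Z\<close> over independent \<open>j\<close> and \<open>k\<close>. Each such difference is at most
  \<open>\<eta> R\<close> times the mean of \<open>e j\<close> and \<open>e k\<close>, and the average of that mean is again \<open>Z\<close>.
\<close>
lemma exp_update_variation:
  assumes N: "finite N" "N \<noteq> {}"
    and q: "\<And>j. j \<in> N \<Longrightarrow> 0 < q t j" "(\<Sum>j\<in>N. q t j) = 1"
    and "0 \<le> \<eta>"
    and L: "\<And>j. j \<in> N \<Longrightarrow> L j t \<in> {A..A + R}"
  shows "(\<Sum>j\<in>N. \<bar>exp_update N \<eta> L q t j - q t j\<bar>) \<le> \<eta> * R"
proof -
  define e where "e j = exp (- \<eta> * L j t)" for j
  define Z where "Z = normalizer N \<eta> L q t"
  have Z: "0 < Z" "(\<Sum>k\<in>N. q t k * e k) = Z"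
    using normalizer_pos[of N q t \<eta> L] N q by (auto simp: Z_def normalizer_def e_def)
  have pair: "\<bar>e j - e k\<bar> \<le> \<eta> * R * ((e j + e k) / 2)" if "j \<in> N" "k \<in> N" for j k
  proof -
    have "- \<eta> * L j t - - \<eta> * L k t = - \<eta> * (L j t - L k t)"
      by (simp add: algebra_simps)
    also have "\<bar>\<dots>\<bar> = \<eta> * \<bar>L j t - L k t\<bar>"
      using \<open>0 \<le> \<eta>\<close> by (simp add: abs_mult)
    also have "\<dots> \<le> \<eta> * R"
      using L[OF that(1)] L[OF that(2)] \<open>0 \<le> \<eta>\<close> by (intro mult_left_mono) auto
    finally show ?thesis
      unfolding e_def
      by (intro order.trans[OF abs_exp_diff_le_mean] mult_right_mono) (auto simp: add_nonneg_nonneg)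
  qed
  have "\<bar>exp_update N \<eta> L q t j - q t j\<bar> \<le> q t j * (\<eta> * R * ((e j + Z) / 2)) / Z"
    if j: "j \<in> N" for j
  proof -
    have "e j - Z = (\<Sum>k\<in>N. q t k * (e j - e k))"
      using q Z by (simp add: right_diff_distrib sum_subtractf flip: sum_distrib_right)
    also have "\<bar>\<dots>\<bar> \<le> (\<Sum>k\<in>N. \<bar>q t k * (e j - e k)\<bar>)" by (rule sum_abs)
    also have "\<dots> \<le> (\<Sum>k\<in>N. q t k * (\<eta> * R * ((e j + e k) / 2)))"
      using q(1) pair[OF j]
      by (intro sum_mono) (simp add: abs_mult less_imp_le mult_left_mono del: times_divide_eq_right)
    also have "\<dots> = \<eta> * R / 2 * (\<Sum>k\<in>N. q t k * e j + q t k * e k)"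
      unfolding sum_distrib_left by (intro sum.cong) (auto simp: algebra_simps)
    also have "\<dots> = \<eta> * R * ((e j + Z) / 2)"
      using q Z by (simp add: sum.distrib flip: sum_distrib_right)
    finally have *: "\<bar>e j - Z\<bar> \<le> \<eta> * R * ((e j + Z) / 2)" .
    have "exp_update N \<eta> L q t j - q t j = q t j * (e j - Z) / Z"
      using Z by (simp add: exp_update_normalizer Z_def e_def field_simps)
    also have "\<bar>\<dots>\<bar> = q t j * \<bar>e j - Z\<bar> / Z"
      using q(1)[OF j] Z by (simp add: abs_mult)
    also have "\<dots> \<le> q t j * (\<eta> * R * ((e j + Z) / 2)) / Z"
      using * q(1)[OF j] Z by (intro divide_right_mono mult_left_mono) auto
    finally show ?thesis .
  qed
  then have "(\<Sum>j\<in>N. \<bar>exp_update N \<eta> L q t j - q t j\<bar>)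
      \<le> (\<Sum>j\<in>N. q t j * (\<eta> * R * ((e j + Z) / 2)) / Z)" by (rule sum_mono)
  also have "\<dots> = \<eta> * R / (2 * Z) * (\<Sum>j\<in>N. q t j * e j + q t j * Z)"
    unfolding sum_distrib_left using Z(1) by (intro sum.cong) (auto simp: field_simps)
  also have "\<dots> = \<eta> * R"
    using q Z by (simp add: sum.distrib flip: sum_distrib_right)
  finally show ?thesis .
qed

text \<open>
  The distance to the uniform distribution is convex, so it is largest at the point masses. The
  termwise estimate in the proof is this convexity: it interpolates between the values
  \<open>1 - 1 / n\<close> at \<open>p j = 1\<close> and \<open>1 / n\<close> at \<open>p j = 0\<close>.
\<close>
lemma sum_abs_diff_uniform_le:
  fixes p :: "'e \<Rightarrow> real"
  assumes "finite N" "N \<noteq> {}" "\<And>j. j \<in> N \<Longrightarrow> 0 \<le> p j" "(\<Sum>j\<in>N. p j) = 1"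
  shows "(\<Sum>j\<in>N. \<bar>1 / real (card N) - p j\<bar>) \<le> 2 * (1 - 1 / real (card N))"
proof -
  define n where "n = real (card N)"
  have n: "1 \<le> n" using assms by (simp add: n_def Suc_le_eq card_gt_0_iff)
  have "\<bar>1 / n - p j\<bar> \<le> p j * (1 - 1 / n) + (1 - p j) * (1 / n)" if "j \<in> N" for j
  proof -
    have "p j \<le> 1" using member_le_sum[of j N p] assms that by auto
    moreover have "0 \<le> p j * (1 - 1 / n)" "0 \<le> (1 - p j) * (1 / n)"
      using assms(3)[OF that] n \<open>p j \<le> 1\<close> by (auto intro!: mult_nonneg_nonneg)
    moreover have "p j * (1 - 1 / n) = p j - p j / n" "(1 - p j) * (1 / n) = 1 / n - p j / n"
      by (simp_all add: algebra_simps diff_divide_distrib)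
    ultimately show ?thesis by linarith
  qed
  then have "(\<Sum>j\<in>N. \<bar>1 / n - p j\<bar>) \<le> (\<Sum>j\<in>N. p j * (1 - 1 / n) + (1 - p j) * (1 / n))"
    by (rule sum_mono)
  also have "\<dots> = (1 - 1 / n) + (n - 1) * (1 / n)"
    using assms(4) by (simp add: sum.distrib sum_subtractf n_def flip: sum_distrib_right sum_divide_distrib)
  also have "\<dots> = 2 * (1 - 1 / n)"
    using n by (simp add: field_simps)
  finally show ?thesis by (simp add: n_def)
qed

lemma fixed_share_variation:
  assumes N: "finite N" "N \<noteq> {}" and "0 \<le> \<alpha>" "\<alpha> < 1" "0 \<le> \<eta>"
    and fs: "fixed_share N \<eta> \<alpha> L q" and t: "1 \<le> t"
    and L: "\<And>j. j \<in> N \<Longrightarrow> L j t \<in> {A..A + R}"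
  shows "(\<Sum>j\<in>N. \<bar>q (t + 1) j - q t j\<bar>) \<le> \<eta> * R + 2 * \<alpha> * (1 - 1 / real (card N))"
proof -
  let ?n = "real (card N)"
  note q = fixed_share_weights[OF N \<open>0 \<le> \<alpha>\<close> \<open>\<alpha> < 1\<close> fs t]
  have "\<bar>q (t + 1) j - q t j\<bar>
      \<le> \<bar>exp_update N \<eta> L q t j - q t j\<bar> + \<alpha> * \<bar>1 / ?n - q t j\<bar>" if "j \<in> N" for j
  proof -
    have "q (t + 1) j - q t j
        = (1 - \<alpha>) * (exp_update N \<eta> L q t j - q t j) + \<alpha> * (1 / ?n - q t j)"
      using fs t that by (simp add: fixed_share_def algebra_simps)
    also have "\<bar>\<dots>\<bar> \<le> (1 - \<alpha>) * \<bar>exp_update N \<eta> L q t j - q t j\<bar> + \<alpha> * \<bar>1 / ?n - q t j\<bar>"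
      using \<open>0 \<le> \<alpha>\<close> \<open>\<alpha> < 1\<close> by (intro order.trans[OF abs_triangle_ineq]) (simp add: abs_mult)
    also have "(1 - \<alpha>) * \<bar>exp_update N \<eta> L q t j - q t j\<bar> \<le> 1 * \<bar>exp_update N \<eta> L q t j - q t j\<bar>"
      using \<open>0 \<le> \<alpha>\<close> by (intro mult_right_mono) auto
    finally show ?thesis by simp
  qed
  then have "(\<Sum>j\<in>N. \<bar>q (t + 1) j - q t j\<bar>)
      \<le> (\<Sum>j\<in>N. \<bar>exp_update N \<eta> L q t j - q t j\<bar> + \<alpha> * \<bar>1 / ?n - q t j\<bar>)" by (rule sum_mono)
  also have "\<dots> = (\<Sum>j\<in>N. \<bar>exp_update N \<eta> L q t j - q t j\<bar>) + \<alpha> * (\<Sum>j\<in>N. \<bar>1 / ?n - q t j\<bar>)"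
    by (simp add: sum.distrib sum_distrib_left)
  also have "\<dots> \<le> \<eta> * R + \<alpha> * (2 * (1 - 1 / ?n))"
    using N q \<open>0 \<le> \<alpha>\<close> \<open>0 \<le> \<eta>\<close> L
    by (intro add_mono mult_left_mono exp_update_variation sum_abs_diff_uniform_le) (auto simp: less_imp_le)
  finally show ?thesis by (simp add: algebra_simps)
qed

section \<open>The exponentially weighted mixture\<close>

text \<open>
  Hoeffding's lemma for a finitely supported distribution, applied to \<open>- x\<close> in order to
  control negative exponents.
\<close>
lemma Hoeffding_finite_mixture:
  fixes p x :: "'e \<Rightarrow> real"
  assumes N: "finite N" and p: "\<And>j. j \<in> N \<Longrightarrow> 0 \<le> p j" "(\<Sum>j\<in>N. p j) = 1"
    and "0 < \<eta>" and x: "\<And>j. j \<in> N \<Longrightarrow> x j \<in> {A..A + R}"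
  shows "(\<Sum>j\<in>N. p j * exp (- \<eta> * x j)) \<le> exp (- \<eta> * (\<Sum>j\<in>N. p j * x j) + \<eta>\<^sup>2 * R\<^sup>2 / 8)"
proof -
  define M where "M = point_measure N (\<lambda>j. ennreal (p j))"
  define \<mu> where "\<mu> = (\<Sum>j\<in>N. p j * x j)"
  have "emeasure M (space M) = (\<Sum>j\<in>N. ennreal (p j))"
    using N by (simp add: M_def emeasure_point_measure_finite space_point_measure)
  also have "\<dots> = 1" using p by simp
  finally interpret M: prob_space M by (rule prob_spaceI)
  interpret interval_bounded_random_variable M "\<lambda>j. - x j" "- (A + R)" "- A"
    by unfold_locales
      (auto simp: M_def AE_point_measure intro!: AE_I2 dest!: x simp: space_point_measure)
  have "M.expectation (\<lambda>j. - x j) = - \<mu>"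
    using N p by (simp add: M_def lebesgue_integral_point_measure_finite \<mu>_def)
  with Hoeffdings_lemma_nn_integral[OF \<open>0 < \<eta>\<close>]
  have "(\<integral>\<^sup>+j. ennreal (exp (\<eta> * (- x j + \<mu>))) \<partial>M) \<le> ennreal (exp (\<eta>\<^sup>2 * R\<^sup>2 / 8))"
    by simp
  also have "(\<integral>\<^sup>+j. ennreal (exp (\<eta> * (- x j + \<mu>))) \<partial>M)
      = ennreal (\<Sum>j\<in>N. p j * exp (\<eta> * (- x j + \<mu>)))"
    using N p by (simp add: M_def nn_integral_point_measure_finite flip: ennreal_mult' sum_ennreal)
  finally have "(\<Sum>j\<in>N. p j * exp (\<eta> * (- x j + \<mu>))) \<le> exp (\<eta>\<^sup>2 * R\<^sup>2 / 8)"
    by simp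
  then have "exp (- \<eta> * \<mu>) * (\<Sum>j\<in>N. p j * exp (\<eta> * (- x j + \<mu>)))
      \<le> exp (- \<eta> * \<mu>) * exp (\<eta>\<^sup>2 * R\<^sup>2 / 8)" by (intro mult_left_mono) auto
  moreover have "exp (- \<eta> * \<mu>) * (\<Sum>j\<in>N. p j * exp (\<eta> * (- x j + \<mu>)))
      = (\<Sum>j\<in>N. p j * exp (- \<eta> * x j))"
    unfolding sum_distrib_left
    by (intro sum.cong refl) (simp add: algebra_simps flip: exp_add)
  ultimately have "(\<Sum>j\<in>N. p j * exp (- \<eta> * x j)) \<le> exp (- \<eta> * \<mu>) * exp (\<eta>\<^sup>2 * R\<^sup>2 / 8)"
    by (simp only:)
  then show ?thesis by (simp only: \<mu>_def exp_add)
qed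

lemma mean_loss_le_mix_loss:
  assumes N: "finite N" "N \<noteq> {}" and q: "\<And>j. j \<in> N \<Longrightarrow> 0 < q t j" "(\<Sum>j\<in>N. q t j) = 1"
    and \<eta>: "0 < \<eta>" and L: "\<And>j. j \<in> N \<Longrightarrow> L j t \<in> {A..A + R}"
  shows "(\<Sum>j\<in>N. q t j * L j t) \<le> - ln (normalizer N \<eta> L q t) / \<eta> + \<eta> / 8 * R\<^sup>2"
proof -
  have "normalizer N \<eta> L q t \<le> exp (- \<eta> * (\<Sum>j\<in>N. q t j * L j t) + \<eta>\<^sup>2 * R\<^sup>2 / 8)"
    unfolding normalizer_def
    by (rule Hoeffding_finite_mixture[where A = A]) (use assms in \<open>auto simp: less_imp_le\<close>)
  then have "ln (normalizer N \<eta> L q t) \<le> ln (exp (- \<eta> * (\<Sum>j\<in>N. q t j * L j t) + \<eta>\<^sup>2 * R\<^sup>2 / 8))"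
    using normalizer_pos[of N q t \<eta> L] N q by (subst ln_le_cancel_iff) auto
  then have "ln (normalizer N \<eta> L q t) \<le> - \<eta> * (\<Sum>j\<in>N. q t j * L j t) + \<eta>\<^sup>2 * R\<^sup>2 / 8"
    by (simp only: ln_exp)
  then show ?thesis using \<eta> by (simp add: field_simps power2_eq_square)
qed

section \<open>Competing with a path of experts\<close>

text \<open>
  The right-hand side is the unnormalised weight that the mixture over all paths gives to being at
  \<open>p s\<close> in round \<open>s\<close>; the left-hand side is the contribution of the single path \<open>p\<close>. In the
  induction step, the share \<open>\<alpha> / n\<close> does not depend on the old expert, and it is at least
  \<open>\<alpha> / n\<close> times the tilted weight of \<open>p s\<close> because that weight is at most 1.
\<close>
lemma prior_path_weight_le:
  assumes N: "finite N" "N \<noteq> {}" and \<alpha>: "0 \<le> \<alpha>" "\<alpha> < 1"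
    and fs: "fixed_share N \<eta> \<alpha> L q"
    and p: "\<And>t. t \<in> {1..s} \<Longrightarrow> p t \<in> N" and s: "1 \<le> s"
  shows "1 / real (card N)
      * (\<Prod>t = 1..<s. \<alpha> / real (card N) + (if p t \<noteq> p (t + 1) then 0 else 1 - \<alpha>))
      * exp (- \<eta> * (\<Sum>t = 1..<s. L (p t) t))
    \<le> q s (p s) * (\<Prod>t = 1..<s. normalizer N \<eta> L q t)"
  using s p
proof (induction s rule: dec_induct)
  case base
  then show ?case using fs by (simp add: fixed_share_def)
next
  case (step s)
  let ?n = "real (card N)" and ?Z = "normalizer N \<eta> L q"
  let ?tr = "\<lambda>t. \<alpha> / ?n + (if p t \<noteq> p (t + 1) then 0 else 1 - \<alpha>)"
  let ?e = "exp (- \<eta> * L (p s) s)" and ?u = "exp_update N \<eta> L q s"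
  have ps: "p s \<in> N" "p (s + 1) \<in> N" using step by auto
  note q = fixed_share_weights[OF N \<alpha> fs]
  have Z: "0 < ?Z t" if "1 \<le> t" for t
    using normalizer_pos[of N q t \<eta> L] N q[OF that] by blast
  have u: "0 \<le> ?u j" "?u j \<le> 1" if "j \<in> N" for j
    using exp_update_pos[of N q s j \<eta> L] exp_update_le_1[of N q s j \<eta> L] N q[OF step.hyps(1)] that
    by (auto simp: less_imp_le)
  have n: "0 \<le> \<alpha> / ?n" using \<alpha> by simp
  have "?tr s * ?u (p s) \<le> q (s + 1) (p (s + 1))"
  proof (cases "p s = p (s + 1)")
    case True
    have "\<alpha> / ?n * ?u (p s) \<le> \<alpha> / ?n" using n u[OF ps(1)] by (rule mult_right_le_one_le)
    then show ?thesis using True fs step.hyps ps by (auto simp: fixed_share_def algebra_simps)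
  next
    case False
    have "\<alpha> / ?n * ?u (p s) \<le> \<alpha> / ?n" using n u[OF ps(1)] by (rule mult_right_le_one_le)
    moreover have "0 \<le> (1 - \<alpha>) * ?u (p (s + 1))" using \<alpha> u[OF ps(2)] by simp
    ultimately show ?thesis using False fs step.hyps ps by (auto simp: fixed_share_def)
  qed
  moreover have "0 \<le> (\<Prod>t = 1..<s. ?Z t)"
    using Z by (intro prod_nonneg) (auto simp: less_imp_le)
  ultimately have "?tr s * ?u (p s) * (?Z s * (\<Prod>t = 1..<s. ?Z t))
      \<le> q (s + 1) (p (s + 1)) * (?Z s * (\<Prod>t = 1..<s. ?Z t))"
    using Z[OF step.hyps(1)] by (intro mult_right_mono) auto
  moreover have "?u (p s) * ?Z s = q s (p s) * ?e"
    using Z[OF step.hyps(1)] by (simp add: exp_update_normalizer)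
  then have "?tr s * ?u (p s) * (?Z s * (\<Prod>t = 1..<s. ?Z t))
      = ?tr s * ?e * (q s (p s) * (\<Prod>t = 1..<s. ?Z t))"
    by (simp only: mult_ac) (simp only: flip: mult.assoc)
  moreover have "?tr s * ?e * (1 / ?n * (\<Prod>t = 1..<s. ?tr t) * exp (- \<eta> * (\<Sum>t = 1..<s. L (p t) t)))
      \<le> ?tr s * ?e * (q s (p s) * (\<Prod>t = 1..<s. ?Z t))"
    using step.IH step.prems \<alpha> n by (intro mult_left_mono) auto
  moreover have "exp (- \<eta> * (\<Sum>t = 1..<Suc s. L (p t) t)) = ?e * exp (- \<eta> * (\<Sum>t = 1..<s. L (p t) t))"
    using step.hyps by (simp add: algebra_simps flip: exp_add)
  ultimately show ?case
    using step.hyps by (simp only: prod.atLeastLessThan_Suc) (simp add: mult_ac)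
qed

text \<open>
  Only an upper bound \<open>K\<close> on the number of exceptional factors \<open>x\<close> is known. The estimate is
  nevertheless free of any comparison between \<open>x\<close> and \<open>z\<close>, since a regular factor \<open>x + z\<close>
  dominates both: as many regular factors as needed to reach \<open>K\<close> are bounded by \<open>x\<close>, and the
  others by \<open>z\<close>.
\<close>
lemma prod_le_few_exceptions:
  fixes x z :: real
  assumes "finite A" "0 \<le> x" "0 \<le> z"
    and k: "card {t \<in> A. P t} \<le> K" and K: "K \<le> card A"
  shows "x ^ K * z ^ (card A - K) \<le> (\<Prod>t\<in>A. x + (if P t then 0 else z))"
proof -
  define k where "k = card {t \<in> A. P t}"
  have "card A = card ({t \<in> A. P t} \<union> {t \<in> A. \<not> P t})" by (rule arg_cong[of _ _ card]) auto
  then have *: "card A = k + card {t \<in> A. \<not> P t}"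
    using assms by (subst (asm) card_Un_disjoint) (auto simp: k_def)
  have "x ^ K * z ^ (card A - K) = x ^ k * (x ^ (K - k) * z ^ (card A - K))"
    using k by (simp add: k_def flip: power_add)
  also have "\<dots> \<le> x ^ k * ((x + z) ^ (K - k) * (x + z) ^ (card A - K))"
    using assms by (intro mult_left_mono mult_mono power_mono) auto
  also have "\<dots> = x ^ k * (x + z) ^ card {t \<in> A. \<not> P t}"
    using K k * by (simp add: k_def flip: power_add)
  also have "\<dots> = (\<Prod>t\<in>A. if P t then x else x + z)"
    using assms by (simp add: prod.If_cases k_def Int_def)
  also have "\<dots> = (\<Prod>t\<in>A. x + (if P t then 0 else z))"
    by (intro prod.cong) auto
  finally show ?thesis .
qed

text \<open>
  The case \<open>\<alpha> = 0\<close>, \<open>K = 0\<close> needs no separate statement: then \<open>(\<alpha> / n)^K = 1\<close>, and the terms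
  with \<open>ln (1 / \<alpha>)\<close> and \<open>ln (1 / (1 - \<alpha>))\<close> vanish.
\<close>
lemma fixed_share_mix_loss_le:
  assumes N: "finite N" "N \<noteq> {}" and \<alpha>: "0 \<le> \<alpha>" "\<alpha> < 1" "\<alpha> = 0 \<Longrightarrow> K = 0"
    and fs: "fixed_share N \<eta> \<alpha> L q" and \<eta>: "0 < \<eta>"
    and T: "1 \<le> T" "K \<le> T - 1" and p: "p \<in> expert_paths N T K"
  shows "(\<Sum>t = 1..T. - ln (normalizer N \<eta> L q t))
    \<le> (real K + 1) * ln (real (card N)) + real K * ln (1 / \<alpha>)
      + (real T - real K - 1) * ln (1 / (1 - \<alpha>)) + \<eta> * (\<Sum>t = 1..T. L (p t) t)"
proof -
  let ?n = "real (card N)" and ?Z = "normalizer N \<eta> L q"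
  let ?S = "\<Sum>t = 1..T. L (p t) t"
  have n: "0 < ?n" using N by (simp add: card_gt_0_iff)
  have pN: "p t \<in> N" if "t \<in> {1..T}" for t
    using p that by (auto simp: expert_paths_def)
  have T_eq: "{1..<T} = {1..T - 1}" "{1..T} = insert T {1..<T}" using T by auto
  have S_eq: "?S = L (p T) T + (\<Sum>t = 1..<T. L (p t) t)"
    unfolding T_eq(2) by simp
  note q = fixed_share_weights[OF N \<alpha>(1,2) fs]
  have Z: "0 < ?Z t" if "1 \<le> t" for t
    using normalizer_pos[of N q t \<eta> L] N q[OF that] by blast
  have "card {t \<in> {1..<T}. p t \<noteq> p (t + 1)} \<le> K"
    using p unfolding T_eq(1) expert_paths_def switches_def by simp
  then have "(\<alpha> / ?n) ^ K * (1 - \<alpha>) ^ (card {1..<T} - K)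
      \<le> (\<Prod>t = 1..<T. \<alpha> / ?n + (if p t \<noteq> p (t + 1) then 0 else 1 - \<alpha>))"
    using \<alpha> T by (intro prod_le_few_exceptions) auto
  then have "1 / ?n * ((\<alpha> / ?n) ^ K * (1 - \<alpha>) ^ (T - 1 - K)) * exp (- \<eta> * (\<Sum>t = 1..<T. L (p t) t))
      \<le> 1 / ?n * (\<Prod>t = 1..<T. \<alpha> / ?n + (if p t \<noteq> p (t + 1) then 0 else 1 - \<alpha>))
        * exp (- \<eta> * (\<Sum>t = 1..<T. L (p t) t))"
    by (intro mult_right_mono mult_left_mono) auto
  also have "\<dots> \<le> q T (p T) * (\<Prod>t = 1..<T. ?Z t)"
    using N \<alpha> fs pN T by (intro prior_path_weight_le) auto
  finally have "1 / ?n * ((\<alpha> / ?n) ^ K * (1 - \<alpha>) ^ (T - 1 - K)) * exp (- \<eta> * (\<Sum>t = 1..<T. L (p t) t))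
      * exp (- \<eta> * L (p T) T) \<le> q T (p T) * (\<Prod>t = 1..<T. ?Z t) * exp (- \<eta> * L (p T) T)"
    by (intro mult_right_mono) auto
  \<comment> \<open>The last round contributes a loss but no transition, so its normalizer is bounded directly.\<close>
  also have "\<dots> = q T (p T) * exp (- \<eta> * L (p T) T) * (\<Prod>t = 1..<T. ?Z t)" by simp
  also have "\<dots> \<le> ?Z T * (\<Prod>t = 1..<T. ?Z t)"
  proof (intro mult_right_mono prod_nonneg)
    show "q T (p T) * exp (- \<eta> * L (p T) T) \<le> ?Z T"
      unfolding normalizer_def
      using N q[OF T(1)] pN[of T] T
      by (intro member_le_sum[of "p T" N "\<lambda>k. q T k * exp (- \<eta> * L k T)"]) (auto simp: less_imp_le)
  qed (use Z in \<open>auto simp: less_imp_le\<close>)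
  also have "\<dots> = (\<Prod>t = 1..T. ?Z t)" unfolding T_eq(2) by simp
  also have "1 / ?n * ((\<alpha> / ?n) ^ K * (1 - \<alpha>) ^ (T - 1 - K)) * exp (- \<eta> * (\<Sum>t = 1..<T. L (p t) t))
      * exp (- \<eta> * L (p T) T) = 1 / ?n * ((\<alpha> / ?n) ^ K * (1 - \<alpha>) ^ (T - 1 - K)) * exp (- \<eta> * ?S)"
    unfolding S_eq by (simp add: algebra_simps flip: exp_add)
  finally have le: "1 / ?n * ((\<alpha> / ?n) ^ K * (1 - \<alpha>) ^ (T - 1 - K)) * exp (- \<eta> * ?S)
      \<le> (\<Prod>t = 1..T. ?Z t)" .
  have K0: "0 < (\<alpha> / ?n) ^ K" using \<alpha> n by (cases "\<alpha> = 0") auto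
  have K1: "ln ((\<alpha> / ?n) ^ K) = - (real K * ln ?n + real K * ln (1 / \<alpha>))"
    using \<alpha> n by (cases "\<alpha> = 0") (auto simp: ln_realpow ln_div algebra_simps)
  have K2: "0 < (1 - \<alpha>) ^ (T - 1 - K)" using \<alpha> by simp
  have K3: "ln ((1 - \<alpha>) ^ (T - 1 - K)) = - ((real T - real K - 1) * ln (1 / (1 - \<alpha>)))"
    using \<alpha> T by (simp add: ln_realpow ln_div of_nat_diff)
  have "ln (1 / ?n * ((\<alpha> / ?n) ^ K * (1 - \<alpha>) ^ (T - 1 - K)) * exp (- \<eta> * ?S))
      \<le> ln (\<Prod>t = 1..T. ?Z t)"
    using le K0 K2 n by (intro ln_mono) (auto intro!: mult_pos_pos)
  also have "ln (1 / ?n * ((\<alpha> / ?n) ^ K * (1 - \<alpha>) ^ (T - 1 - K)) * exp (- \<eta> * ?S))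
      = - ln ?n + (ln ((\<alpha> / ?n) ^ K) + ln ((1 - \<alpha>) ^ (T - 1 - K))) - \<eta> * ?S"
  proof -
    have "ln (1 / ?n * ((\<alpha> / ?n) ^ K * (1 - \<alpha>) ^ (T - 1 - K)) * exp (- \<eta> * ?S))
        = ln (1 / ?n) + (ln ((\<alpha> / ?n) ^ K) + ln ((1 - \<alpha>) ^ (T - 1 - K))) + ln (exp (- \<eta> * ?S))"
      using K0 K2 n by (simp only: ln_mult_pos mult_pos_pos exp_gt_zero divide_pos_pos zero_less_one)
    then show ?thesis using n by (simp add: ln_div)
  qed
  also have "ln (\<Prod>t = 1..T. ?Z t) = (\<Sum>t = 1..T. ln (?Z t))"
    using Z[THEN less_imp_neq, THEN not_sym] by (intro ln_prod) auto
  finally show ?thesis unfolding K1 K3 by (simp add: sum_negf algebra_simps)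
qed

section \<open>The tracking regret\<close>

lemma cs_loss_bounds:
  assumes "a \<le> l (v t) (y t)" "l (v t) (y t) \<le> b" "0 \<le> c t"
    and "v t \<in> portfolios" "v (t - 1) \<in> portfolios"
  shows "cs_loss l y c v t \<in> {a..a + (b - a + 2 * c t)}"
  using assms mult_left_mono[OF l1_norm_portfolio_diff_le[OF assms(4,5)] assms(3)]
    mult_nonneg_nonneg[OF assms(3) l1_norm_nonneg[of "v t - v (t - 1)"]]
  by (simp add: cs_loss_def)

text \<open>
  Constant paths make the set of competitors nonempty for every \<open>K\<close>, so the minimum is attained.
\<close>
lemma expert_path_minimum:
  fixes f :: "(nat \<Rightarrow> 'e) \<Rightarrow> real"
  assumes "finite N" "N \<noteq> {}"
  shows "\<exists>p\<in>expert_paths N T K. (MIN p\<in>expert_paths N T K. f p) = f p"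
proof -
  obtain j where "j \<in> N" using assms by blast
  have "{t \<in> {1..T - 1}. restrict (\<lambda>_. j) {1..T} t \<noteq> restrict (\<lambda>_. j) {1..T} (t + 1)} = {}"
    by auto
  then have no_switch: "switches T (restrict (\<lambda>_. j) {1..T}) = 0"
    unfolding switches_def by (simp only: card.empty)
  have "restrict (\<lambda>_. j) {1..T} \<in> expert_paths N T K"
    using \<open>j \<in> N\<close> unfolding expert_paths_def by (simp only: no_switch mem_Collect_eq) auto
  moreover have "finite (expert_paths N T K)"
    unfolding expert_paths_def using assms by (intro finite_subset[OF _ finite_PiE[of "{1..T}" "\<lambda>_. N"]]) auto
  ultimately have "(MIN p\<in>expert_paths N T K. f p) \<in> f ` expert_paths N T K"
    by (intro Min_in) auto
  then show ?thesis by auto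
qed

text \<open>
  The reference weights \<open>q'\<close> are left open so that round 1 is covered: there the previous aggregate
  \<open>w0\<close> is the mixture of the experts' initial portfolios under any weights that sum to 1.
\<close>
lemma aggregate_loss_le:
  fixes w :: "'e \<Rightarrow> nat \<Rightarrow> real ^ 'm" and l :: "real ^ 'm \<Rightarrow> 'y \<Rightarrow> real"
  assumes N: "finite N" "N \<noteq> {}"
    and q: "\<And>j. j \<in> N \<Longrightarrow> 0 \<le> q t j" "(\<Sum>j\<in>N. q t j) = 1"
    and conv: "convex_on portfolios (\<lambda>u. l u (y t))"
    and w: "\<And>j s. j \<in> N \<Longrightarrow> w j s \<in> portfolios"
    and "0 \<le> c t"
    and prev: "aggregate N w0 w q (t - 1) = (\<Sum>j\<in>N. q' j *\<^sub>R w j (t - 1))" and t: "1 \<le> t"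
  shows "cs_loss l y c (aggregate N w0 w q) t
    \<le> (\<Sum>j\<in>N. q t j * cs_loss l y c (w j) t) + c t * (\<Sum>j\<in>N. \<bar>q t j - q' j\<bar>)"
proof -
  have agg: "aggregate N w0 w q t = (\<Sum>j\<in>N. q t j *\<^sub>R w j t)"
    using t by (simp add: aggregate_def)
  have "l (aggregate N w0 w q t) (y t) \<le> (\<Sum>j\<in>N. q t j * l (w j t) (y t))"
    unfolding agg by (rule convex_on_sum[OF N conv]) (use q w in auto)
  moreover have "l1_norm (aggregate N w0 w q t - aggregate N w0 w q (t - 1))
      \<le> (\<Sum>j\<in>N. q t j * l1_norm (w j t - w j (t - 1))) + (\<Sum>j\<in>N. \<bar>q t j - q' j\<bar>)"
    unfolding agg prev by (rule l1_norm_mixture_diff_le) (use q w in auto)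
  then have "c t * l1_norm (aggregate N w0 w q t - aggregate N w0 w q (t - 1))
      \<le> c t * (\<dots>)" using \<open>0 \<le> c t\<close> by (rule mult_left_mono)
  ultimately have "cs_loss l y c (aggregate N w0 w q) t
      \<le> (\<Sum>j\<in>N. q t j * l (w j t) (y t))
        + c t * ((\<Sum>j\<in>N. q t j * l1_norm (w j t - w j (t - 1))) + (\<Sum>j\<in>N. \<bar>q t j - q' j\<bar>))"
    unfolding cs_loss_def by (rule add_mono)
  also have "\<dots> = (\<Sum>j\<in>N. q t j * cs_loss l y c (w j) t) + c t * (\<Sum>j\<in>N. \<bar>q t j - q' j\<bar>)"
    by (simp add: cs_loss_def distrib_left sum.distrib sum_distrib_left mult_ac)
  finally show ?thesis .
qed


theorem corollary3p4:
  fixes N :: "'e set"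
    and l :: "real ^ 'm \<Rightarrow> real ^ 'm \<Rightarrow> real"
    and Y :: "(real ^ 'm) set"
    and y :: "nat \<Rightarrow> real ^ 'm"
    and w0 :: "real ^ 'm"
    and w :: "'e \<Rightarrow> nat \<Rightarrow> real ^ 'm"
    and q :: "nat \<Rightarrow> 'e \<Rightarrow> real"
    and c :: "nat \<Rightarrow> real"
    and a b \<eta> \<alpha> :: real
    and T K :: nat
  assumes "CARD('m) \<ge> 2"
    and "finite N" and "card N \<ge> 2"
    and "a < b"
    and "\<And>v. v \<in> Y \<Longrightarrow> convex_on portfolios (\<lambda>u. l u v)"
    and "\<And>u v. u \<in> portfolios \<Longrightarrow> v \<in> Y \<Longrightarrow> a \<le> l u v \<and> l u v \<le> b"
    and "w0 \<in> portfolios"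
    and "\<And>j. j \<in> N \<Longrightarrow> w j 0 = w0"
    and "\<And>j t. j \<in> N \<Longrightarrow> t \<ge> 1 \<Longrightarrow> w j t \<in> portfolios"
    and "\<And>t. t \<ge> 1 \<Longrightarrow> y t \<in> Y"
    and "T \<ge> 1" and "K \<in> {0..T - 1}"
    and "\<And>t. t \<in> {1..T} \<Longrightarrow> c t \<ge> 0"
    and "\<eta> > 0" and "0 \<le> \<alpha>" and "\<alpha> < 1"
    and "fixed_share N \<eta> \<alpha> (\<lambda>j. cs_loss l y c (w j)) q"
  shows "ereal (tracking_regret N l y c w0 w q T K)
    \<le> complexity K \<alpha> (card N) T / ereal \<eta>
      + ereal (\<eta> / 8 * (\<Sum>t = 1..T. (b - a + 2 * c t)\<^sup>2)
               + \<eta> * (\<Sum>t = 2..T. c t * (b - a + 2 * c (t - 1)))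
               + 2 * \<alpha> * (1 - 1 / real (card N)) * (\<Sum>t = 1..T. c t))"
proof (cases "\<alpha> = 0 \<and> K > 0")
  case True
  then show ?thesis using \<open>\<eta> > 0\<close> by (simp add: complexity_def)
next
  case False
  note N = \<open>finite N\<close>
  have N_ne: "N \<noteq> {}" using \<open>card N \<ge> 2\<close> by auto
  note fs = \<open>fixed_share N \<eta> \<alpha> (\<lambda>j. cs_loss l y c (w j)) q\<close>
  note \<alpha> = \<open>0 \<le> \<alpha>\<close> \<open>\<alpha> < 1\<close>
  note c = \<open>\<And>t. t \<in> {1..T} \<Longrightarrow> c t \<ge> 0\<close>
  define L where "L = (\<lambda>j. cs_loss l y c (w j))"
  let ?n = "real (card N)" and ?R = "\<lambda>t. b - a + 2 * c t"
  let ?B = "2 * \<alpha> * (1 - 1 / ?n)"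
  let ?mix = "\<lambda>t. - ln (normalizer N \<eta> L q t)"
  have w: "w j t \<in> portfolios" if "j \<in> N" for j t
    using assms(7-9) that by (cases "t = 0") auto
  have L_range: "L j t \<in> {a..a + ?R t}" if "j \<in> N" "t \<in> {1..T}" for j t
    unfolding L_def using assms(6,10) w that c by (intro cs_loss_bounds) auto
  have q: "(\<forall>j\<in>N. 0 < q t j) \<and> (\<Sum>j\<in>N. q t j) = 1" if "1 \<le> t" for t
    using fixed_share_weights[OF N N_ne \<alpha> fs that] .
  have mean: "(\<Sum>j\<in>N. q t j * L j t) \<le> ?mix t / \<eta> + \<eta> / 8 * (?R t)\<^sup>2" if "t \<in> {1..T}" for t
    using q[of t] that N N_ne \<open>\<eta> > 0\<close> L_range by (intro mean_loss_le_mix_loss[where A = a]) auto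
  have agg: "cs_loss l y c (aggregate N w0 w q) t
      \<le> (\<Sum>j\<in>N. q t j * L j t) + c t * (\<Sum>j\<in>N. \<bar>q t j - q' j\<bar>)"
    if "t \<in> {1..T}" "aggregate N w0 w q (t - 1) = (\<Sum>j\<in>N. q' j *\<^sub>R w j (t - 1))" for t q'
    unfolding L_def using q[of t] that N N_ne w c assms(5,10)
    by (intro aggregate_loss_le) (auto simp: less_imp_le)
  have B: "0 \<le> ?B" using \<alpha> \<open>card N \<ge> 2\<close> by (intro mult_nonneg_nonneg) auto
  have first: "cs_loss l y c (aggregate N w0 w q) 1
      \<le> ?mix 1 / \<eta> + \<eta> / 8 * (?R 1)\<^sup>2 + ?B * c 1"
  proof -
    \<comment> \<open>Taking the reference weights equal to the current ones makes the variation term vanish.\<close>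
    have "aggregate N w0 w q (1 - 1) = (\<Sum>j\<in>N. q 1 j *\<^sub>R w j (1 - 1))"
      using assms(8) q[of 1] by (simp add: aggregate_def flip: scaleR_left.sum)
    from agg[OF _ this] have "cs_loss l y c (aggregate N w0 w q) 1 \<le> (\<Sum>j\<in>N. q 1 j * L j 1)"
      using \<open>T \<ge> 1\<close> by simp
    moreover have "1 \<in> {1..T}" using \<open>T \<ge> 1\<close> by simp
    ultimately show ?thesis
      using mean[of 1] mult_nonneg_nonneg[OF B c[of 1]] by linarith
  qed
  have later: "cs_loss l y c (aggregate N w0 w q) t
      \<le> ?mix t / \<eta> + \<eta> / 8 * (?R t)\<^sup>2 + ?B * c t + \<eta> * (c t * ?R (t - 1))" if "t \<in> {2..T}" for t
  proof -
    have "aggregate N w0 w q (t - 1) = (\<Sum>j\<in>N. q (t - 1) j *\<^sub>R w j (t - 1))"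
      using that by (simp add: aggregate_def)
    moreover have "t - 1 \<in> {1..T}" using that by auto
    then have "(\<Sum>j\<in>N. \<bar>q (t - 1 + 1) j - q (t - 1) j\<bar>) \<le> \<eta> * ?R (t - 1) + ?B"
      using N N_ne \<alpha> \<open>\<eta> > 0\<close> fs[folded L_def] L_range
      by (intro fixed_share_variation[where A = a]) auto
    with that have "c t * (\<Sum>j\<in>N. \<bar>q t j - q (t - 1) j\<bar>) \<le> c t * (\<eta> * ?R (t - 1) + ?B)"
      using that c by (intro mult_left_mono) auto
    moreover have "c t * (\<eta> * ?R (t - 1) + ?B) = \<eta> * (c t * ?R (t - 1)) + ?B * c t"
      by (simp add: algebra_simps)
    moreover have "t \<in> {1..T}" using that by auto
    ultimately show ?thesis using agg[of t "q (t - 1)"] mean[of t] by linarith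
  qed
  have split: "(\<Sum>t = 1..T. f t) = f 1 + (\<Sum>t = 2..T. f t)" for f :: "nat \<Rightarrow> real"
    using \<open>T \<ge> 1\<close> by (simp add: sum.atLeast_Suc_atMost numeral_2_eq_2)
  have total: "(\<Sum>t = 1..T. cs_loss l y c (aggregate N w0 w q) t)
      \<le> (\<Sum>t = 1..T. ?mix t) / \<eta> + \<eta> / 8 * (\<Sum>t = 1..T. (?R t)\<^sup>2)
        + ?B * (\<Sum>t = 1..T. c t) + \<eta> * (\<Sum>t = 2..T. c t * ?R (t - 1))"
  proof -
    have "(\<Sum>t = 2..T. cs_loss l y c (aggregate N w0 w q) t)
      \<le> (\<Sum>t = 2..T. ?mix t / \<eta> + \<eta> / 8 * (?R t)\<^sup>2 + ?B * c t + \<eta> * (c t * ?R (t - 1)))"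
      using later by (rule sum_mono)
    also have "\<dots> = (\<Sum>t = 2..T. ?mix t) / \<eta> + \<eta> / 8 * (\<Sum>t = 2..T. (?R t)\<^sup>2)
        + ?B * (\<Sum>t = 2..T. c t) + \<eta> * (\<Sum>t = 2..T. c t * ?R (t - 1))"
      by (simp only: sum.distrib sum_distrib_left sum_divide_distrib)
    finally show ?thesis
      using first unfolding split by (simp only: distrib_left add_divide_distrib)
  qed
  obtain p where p: "p \<in> expert_paths N T K"
    "(MIN p\<in>expert_paths N T K. \<Sum>t = 1..T. L (p t) t) = (\<Sum>t = 1..T. L (p t) t)"
    using expert_path_minimum[OF N N_ne, of T K "\<lambda>p. \<Sum>t = 1..T. L (p t) t"] by blast
  define C where "C = (real K + 1) * ln ?n + real K * ln (1 / \<alpha>)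
    + (real T - real K - 1) * ln (1 / (1 - \<alpha>))"
  have C: "complexity K \<alpha> (card N) T = ereal C"
    using False by (auto simp: complexity_def C_def)
  have "(\<Sum>t = 1..T. ?mix t) \<le> C + \<eta> * (\<Sum>t = 1..T. L (p t) t)"
    unfolding C_def using N N_ne \<alpha> fs[folded L_def] \<open>\<eta> > 0\<close> \<open>T \<ge> 1\<close> \<open>K \<in> {0..T - 1}\<close> p(1) False
    by (intro fixed_share_mix_loss_le) auto
  then have "(\<Sum>t = 1..T. ?mix t) / \<eta> \<le> C / \<eta> + (\<Sum>t = 1..T. L (p t) t)"
    using \<open>\<eta> > 0\<close> by (simp add: field_simps)
  with total p(2) have "tracking_regret N l y c w0 w q T K
      \<le> C / \<eta> + (\<eta> / 8 * (\<Sum>t = 1..T. (?R t)\<^sup>2)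
        + \<eta> * (\<Sum>t = 2..T. c t * ?R (t - 1)) + ?B * (\<Sum>t = 1..T. c t))"
    unfolding tracking_regret_def L_def by linarith
  then show ?thesis using \<open>\<eta> > 0\<close> by (simp add: C)
qed

end
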